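(* Let $(X,d)$ be a metric space and let $\mathcal{S}$ be a bornology on $X$. Then the following statements are equivalent: (i) $\tau_{\mathcal{S},d}^- = \mathcal{S}^-$ on $CL(X)$ (i.e. a net in $CL(X)$ is $\tau_{\mathcal{S},d}^-$-convergent to an element of $CL(X)$ if and only if it is $\mathcal{S}^-$-convergent to it); (ii) for all $S \in \mathcal{S}$, $A \in CL(X)$ and $f,g \in \mathcal{Z}^+$ with $\inf_{x \in S}(g(x)-f(x))>0$, whenever $A$ hits $B_d(S,f)$ pointwise, there exists $S' \in \mathcal{S}$ such that $A \cap S'$ hits $B_d(S,g)$ pointwise; (iii) for all $S \in \mathcal{S}$, $A \in CL(X)$ and $f,g \in L(\mathcal{Z}^+)$ with $\inf_{x \in S}(g(x)-f(x))>0$, whenever $A$ hits $B_d(S,f)$ pointwise, there exists $S' \in \mathcal{S}$ such that $A \cap S'$ hits $B_d(S,g)$ pointwise.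
   Context: A bornology on a metric space $(X,d)$ is a nonempty family $\mathcal{S}$ of nonempty subsets of $X$ that is hereditary (nonempty subsets of members are members), stable under finite unions, and covers $X$. $CL(X)$ is the collection of all nonempty closed subsets of $X$. $d(x,A)=\inf_{a\in A}d(x,a)$; $B_d(x,r)$ is the open ball of radius $r$; for $\epsilon>0$, $B_d(A,\epsilon)=\{x\in X: d(x,A)<\epsilon\}$. $\mathcal{Z}^+$ is the set of all functions $f:X\to\mathbb{R}$ with $f(x)>0$ for all $x\in X$; $L(\mathcal{Z}^+)$ is the set of Lipschitz members of $\mathcal{Z}^+$. For $C\subseteq X$ and $f\in\mathcal{Z}^+$, $B_d(C,f)=\bigcup_{x\in C}B_d(x,f(x))$. A set $A$ hits $B_d(C,f)$ pointwise (hits the $f$-enlargement of $C$ pointwise) if $A\cap B_d(x,f(x))\neq\emptyset$ for every $x\in C$. A net $(A_\lambda)$ is $\tau_{\mathcal{S},d}^-$-convergent to $A$ if for every $\epsilon>0$ and $S\in\mathcal{S}$, eventually $d(x,A_\lambda)-d(x,A)<\epsilon$ for all $x\in S$. It is $\mathcal{S}^-$-convergent to $A$ if for every $\epsilon>0$ and $S\in\mathcal{S}$, eventually $A\cap S\subseteq B_d(A_\lambda,\epsilon)$. *)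

theory Defs
  imports "HOL-Analysis.Analysis"
begin

text \<open>The metric space \<open>X\<close> is the whole of a type of class \<^class>\<open>metric_space\<close>;
  \<open>d(x,A)\<close> is \<^const>\<open>infdist\<close> and \<open>B_d(x,r)\<close> is \<^const>\<open>ball\<close>.\<close>

definition bornology :: "'a set set \<Rightarrow> bool" where
  "bornology \<S> \<longleftrightarrow>
     \<S> \<noteq> {} \<and> {} \<notin> \<S> \<and>
     (\<forall>S\<in>\<S>. \<forall>T. T \<noteq> {} \<and> T \<subseteq> S \<longrightarrow> T \<in> \<S>) \<and>
     (\<forall>\<F>. finite \<F> \<and> \<F> \<noteq> {} \<and> \<F> \<subseteq> \<S> \<longrightarrow> \<Union>\<F> \<in> \<S>) \<and>
     \<Union>\<S> = UNIV"

definition CL :: "'a::metric_space set set" where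
  "CL = {A. closed A \<and> A \<noteq> {}}"

text \<open>Only used for nonempty \<open>A\<close>: the library sets \<^term>\<open>infdist x {} = 0\<close>.\<close>
definition set_enlargement :: "'a::metric_space set \<Rightarrow> real \<Rightarrow> 'a set" where
  "set_enlargement A \<epsilon> = {x. infdist x A < \<epsilon>}"

definition Zplus :: "('a::metric_space \<Rightarrow> real) set" where
  "Zplus = {f. \<forall>x. f x > 0}"

definition LZplus :: "('a::metric_space \<Rightarrow> real) set" where
  "LZplus = {f \<in> Zplus. \<exists>L. L-lipschitz_on UNIV f}"

definition hits_pointwise ::
    "'a::metric_space set \<Rightarrow> 'a set \<Rightarrow> ('a \<Rightarrow> real) \<Rightarrow> bool" where
  "hits_pointwise A C f \<longleftrightarrow> (\<forall>x\<in>C. A \<inter> ball x (f x) \<noteq> {})"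

text \<open>The infimum is taken in the extended reals, so that it is \<open>-\<infinity>\<close>
  (and hence not positive) when \<open>g - f\<close> is unbounded below on \<open>S\<close>.\<close>
definition uniformly_below_on :: "'a set \<Rightarrow> ('a \<Rightarrow> real) \<Rightarrow> ('a \<Rightarrow> real) \<Rightarrow> bool" where
  "uniformly_below_on S f g \<longleftrightarrow> (INF x\<in>S. ereal (g x - f x)) > 0"

text \<open>A net is a function on a directed set, given by a carrier \<open>D\<close> and a relation \<open>le\<close>
  that matters only on \<open>D\<close>; antisymmetry is not required.\<close>
definition directed_set :: "'i set \<Rightarrow> ('i \<Rightarrow> 'i \<Rightarrow> bool) \<Rightarrow> bool" where
  "directed_set D le \<longleftrightarrow>
     D \<noteq> {} \<and>
     (\<forall>i\<in>D. le i i) \<and>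
     (\<forall>i\<in>D. \<forall>j\<in>D. \<forall>k\<in>D. le i j \<and> le j k \<longrightarrow> le i k) \<and>
     (\<forall>i\<in>D. \<forall>j\<in>D. \<exists>k\<in>D. le i k \<and> le j k)"

definition net_eventually ::
    "'i set \<Rightarrow> ('i \<Rightarrow> 'i \<Rightarrow> bool) \<Rightarrow> ('i \<Rightarrow> bool) \<Rightarrow> bool" where
  "net_eventually D le P \<longleftrightarrow> (\<exists>i\<in>D. \<forall>j\<in>D. le i j \<longrightarrow> P j)"

definition tau_minus_convergent ::
    "'a::metric_space set set \<Rightarrow> 'i set \<Rightarrow> ('i \<Rightarrow> 'i \<Rightarrow> bool) \<Rightarrow>
     ('i \<Rightarrow> 'a set) \<Rightarrow> 'a set \<Rightarrow> bool" where
  "tau_minus_convergent \<S> D le N A \<longleftrightarrow>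
     (\<forall>\<epsilon>>0. \<forall>S\<in>\<S>.
        net_eventually D le (\<lambda>i. \<forall>x\<in>S. infdist x (N i) - infdist x A < \<epsilon>))"

definition S_minus_convergent ::
    "'a::metric_space set set \<Rightarrow> 'i set \<Rightarrow> ('i \<Rightarrow> 'i \<Rightarrow> bool) \<Rightarrow>
     ('i \<Rightarrow> 'a set) \<Rightarrow> 'a set \<Rightarrow> bool" where
  "S_minus_convergent \<S> D le N A \<longleftrightarrow>
     (\<forall>\<epsilon>>0. \<forall>S\<in>\<S>.
        net_eventually D le (\<lambda>i. A \<inter> S \<subseteq> set_enlargement (N i) \<epsilon>))"

text \<open>Equality of the two convergences on \<open>CL\<close>. HOL cannot quantify over index types
  inside a formula, so the index sets range over all subsets of one type \<open>'i\<close>, fixed by the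
  first argument. The notion depends on \<open>'i\<close>, and for small \<open>'i\<close> it is weaker than agreement
  on all nets. At \<open>'a set + 'j\<close> with \<open>'j\<close> arbitrary, it covers nets indexed by families
  of subsets of the space as well as every net with indices in \<open>'j\<close>.\<close>
definition minus_convergences_agree :: "'i itself \<Rightarrow> 'a::metric_space set set \<Rightarrow> bool" where
  "minus_convergences_agree (_ :: 'i itself) \<S> \<longleftrightarrow>
     (\<forall>(D :: 'i set) le N. \<forall>A\<in>CL.
        directed_set D le \<and> (\<forall>i\<in>D. N i \<in> CL) \<longrightarrow>
        (tau_minus_convergent \<S> D le N A \<longleftrightarrow> S_minus_convergent \<S> D le N A))"

end

theory Submission
  imports Defs
begin

text \<open>\<open>\<tau>\<^sup>-\<close>-convergence always implies \<open>\<S>\<^sup>-\<close>-convergence. For the reverse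
  implication one takes \<open>f\<close> and \<open>g\<close> to be \<open>d(\<cdot>,A)\<close> plus small constants, which are
  Lipschitz: a member \<open>S'\<close> for which \<open>A \<inter> S'\<close> hits the \<open>g\<close>-enlargement of \<open>S\<close> pointwise
  controls \<open>d(x,A)\<close> uniformly on \<open>S\<close>. Conversely, the net \<open>S' \<mapsto> closure (A \<inter> S')\<close>,
  directed by inclusion, always \<open>\<S>\<^sup>-\<close>-converges to \<open>A\<close>, and its \<open>\<tau>\<^sup>-\<close>-convergence
  yields the required \<open>S'\<close>.\<close>

lemma bornology_Un:
  assumes "bornology \<S>" "S \<in> \<S>" "T \<in> \<S>"
  shows "S \<union> T \<in> \<S>"
proof -
  have "finite \<F> \<and> \<F> \<noteq> {} \<and> \<F> \<subseteq> \<S> \<longrightarrow> \<Union>\<F> \<in> \<S>" for \<F>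
    using assms(1) by (simp add: bornology_def)
  from this[of "{S, T}"] show ?thesis using assms(2,3) by simp
qed

lemma bornology_nonempty: "bornology \<S> \<Longrightarrow> S \<in> \<S> \<Longrightarrow> S \<noteq> {}"
  by (metis bornology_def)

lemma bornology_covers:
  assumes "bornology \<S>"
  obtains S where "S \<in> \<S>" "x \<in> S"
proof -
  have "x \<in> \<Union>\<S>" using assms by (simp add: bornology_def)
  then show thesis using that by blast
qed

text \<open>Trades the extended-real infimum for a uniform real gap: when it is positive, density
  puts a real \<delta> strictly between 0 and it.\<close>

lemma uniformly_below_on_iff:
  assumes "S \<noteq> {}"
  shows "uniformly_below_on S f g \<longleftrightarrow> (\<exists>\<delta>>0. \<forall>x\<in>S. f x + \<delta> \<le> g x)"
proof
  assume "uniformly_below_on S f g"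
  then obtain \<delta> where \<delta>: "0 < ereal \<delta>" "ereal \<delta> < (INF x\<in>S. ereal (g x - f x))"
    unfolding uniformly_below_on_def using ereal_dense2 by blast
  have "f x + \<delta> \<le> g x" if "x \<in> S" for x
  proof -
    have "ereal \<delta> < ereal (g x - f x)"
      using \<delta>(2) INF_lower[OF that, of "\<lambda>x. ereal (g x - f x)"] by (rule less_le_trans)
    then show ?thesis by simp
  qed
  with \<delta>(1) show "\<exists>\<delta>>0. \<forall>x\<in>S. f x + \<delta> \<le> g x" by auto
next
  assume "\<exists>\<delta>>0. \<forall>x\<in>S. f x + \<delta> \<le> g x"
  then obtain \<delta> where \<delta>: "\<delta> > 0" "\<forall>x\<in>S. f x + \<delta> \<le> g x" by blast
  have "ereal \<delta> \<le> (INF x\<in>S. ereal (g x - f x))"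
    by (rule INF_greatest) (use \<delta>(2) in \<open>auto simp: le_diff_eq add.commute\<close>)
  moreover have "0 < ereal \<delta>" using \<delta>(1) by simp
  ultimately show "uniformly_below_on S f g"
    unfolding uniformly_below_on_def by (rule less_le_trans[rotated])
qed

lemma infdist_less_obtain:
  assumes "A \<noteq> {}" "infdist x A < r"
  obtains a where "a \<in> A" "dist x a < r"
proof -
  have "(INF a\<in>A. dist x a) < r"
    using assms by (simp add: infdist_notempty)
  then obtain a where "a \<in> A" "dist x a < r"
    unfolding cINF_less_iff[OF assms(1) bdd_below_image_dist] by blast
  then show thesis by (rule that)
qed

text \<open>Supplies the Lipschitz test functions: the distance to a set is 1-Lipschitz, and the
  constant keeps the sum positive where the distance vanishes.\<close>

lemma infdist_add_const_in_LZplus: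
  assumes "c > 0"
  shows "(\<lambda>x. infdist x A + c) \<in> LZplus"
proof -
  have "1-lipschitz_on UNIV (\<lambda>x. infdist x A + c)"
    by (rule lipschitz_onI) (auto simp: dist_real_def infdist_triangle_abs)
  moreover have "infdist x A + c > 0" for x
    using infdist_nonneg assms by (rule add_nonneg_pos)
  ultimately show ?thesis unfolding LZplus_def Zplus_def by blast
qed

text \<open>At points of \<open>A \<inter> S\<close> the term \<open>infdist x A\<close> is 0, so
  there the \<tau>-inequality is exactly membership in the \<epsilon>-enlargement.\<close>

lemma tau_minus_imp_S_minus:
  assumes "tau_minus_convergent \<S> D le N A"
  shows "S_minus_convergent \<S> D le N A"
  unfolding S_minus_convergent_def
proof (intro allI impI ballI)
  fix \<epsilon> :: real and S assume "\<epsilon> > 0" "S \<in> \<S>"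
  then have "net_eventually D le (\<lambda>i. \<forall>x\<in>S. infdist x (N i) - infdist x A < \<epsilon>)"
    using assms unfolding tau_minus_convergent_def by blast
  moreover have "A \<inter> S \<subseteq> set_enlargement M \<epsilon>"
    if "\<forall>x\<in>S. infdist x M - infdist x A < \<epsilon>" for M
    using that by (force simp: set_enlargement_def)
  ultimately show "net_eventually D le (\<lambda>i. A \<inter> S \<subseteq> set_enlargement (N i) \<epsilon>)"
    unfolding net_eventually_def by meson
qed

lemma S_minus_imp_tau_minus:
  fixes \<S> :: "'a::metric_space set set"
  assumes bor: "bornology \<S>" and A: "A \<in> CL"
    and hits: "\<forall>S\<in>\<S>. \<forall>f\<in>LZplus. \<forall>g\<in>LZplus.
      uniformly_below_on S f g \<longrightarrow> hits_pointwise A S f \<longrightarrow>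
      (\<exists>S'\<in>\<S>. hits_pointwise (A \<inter> S') S g)"
    and conv: "S_minus_convergent \<S> D le N A"
  shows "tau_minus_convergent \<S> D le N A"
  unfolding tau_minus_convergent_def
proof (intro allI impI ballI)
  fix \<epsilon> :: real and S assume \<epsilon>: "\<epsilon> > 0" and S: "S \<in> \<S>"
  have A_ne: "A \<noteq> {}" using A by (simp add: CL_def)
  \<comment> \<open>The gap between \<open>f\<close> and \<open>g\<close> is \<epsilon>/4. The
    \<epsilon>/2 in \<open>g\<close> and the \<epsilon>/4 enlargement used below add up to less than
    \<epsilon>.\<close>
  define f where "f = (\<lambda>x. infdist x A + \<epsilon> / 4)"
  define g where "g = (\<lambda>x. infdist x A + \<epsilon> / 2)"
  have fg: "f \<in> LZplus" "g \<in> LZplus"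
    unfolding f_def g_def using \<epsilon> by (auto intro!: infdist_add_const_in_LZplus)
  have "uniformly_below_on S f g"
    unfolding uniformly_below_on_iff[OF bornology_nonempty[OF bor S]]
    by (rule exI[of _ "\<epsilon> / 4"]) (use \<epsilon> in \<open>auto simp: f_def g_def\<close>)
  moreover have "hits_pointwise A S f"
    unfolding hits_pointwise_def
  proof
    fix x
    have "infdist x A < f x" using \<epsilon> by (simp add: f_def)
    then obtain a where "a \<in> A" "dist x a < f x" by (rule infdist_less_obtain[OF A_ne])
    then show "A \<inter> ball x (f x) \<noteq> {}" by auto
  qed
  ultimately obtain S' where S': "S' \<in> \<S>" "hits_pointwise (A \<inter> S') S g"
    using hits S fg by blast
  have "net_eventually D le (\<lambda>i. A \<inter> S' \<subseteq> set_enlargement (N i) (\<epsilon> / 4))"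
    using conv S'(1) \<epsilon> unfolding S_minus_convergent_def by simp
  moreover have "infdist x M - infdist x A < \<epsilon>"
    if M: "A \<inter> S' \<subseteq> set_enlargement M (\<epsilon> / 4)" and x: "x \<in> S" for x M
  proof -
    \<comment> \<open>The point \<open>a\<close> links \<open>x\<close> to \<open>M\<close>: it is
      nearly as close to \<open>x\<close> as \<open>A\<close> is, and it lies in \<open>S'\<close>,
      where \<open>M\<close> is known to be close.\<close>
    obtain a where a: "a \<in> A \<inter> S'" "dist x a < g x"
      using S'(2) x unfolding hits_pointwise_def by fastforce
    then have "infdist a M < \<epsilon> / 4" using M by (auto simp: set_enlargement_def)
    then show ?thesis
      using infdist_triangle[of x M a] a(2) \<epsilon> by (simp add: g_def)
  qed
  ultimately show "net_eventually D le (\<lambda>i. \<forall>x\<in>S. infdist x (N i) - infdist x A < \<epsilon>)"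
    unfolding net_eventually_def by meson
qed

text \<open>The injection \<open>h\<close> encodes subsets of the space as indices in
  \<open>'i\<close>, so that the net of truncations of \<open>A\<close> is among those covered by
  \<open>agree\<close>.\<close>

lemma hits_pointwise_if_minus_convergences_agree:
  fixes \<S> :: "'a::metric_space set set" and h :: "'a set \<Rightarrow> 'i"
  assumes bor: "bornology \<S>" and h: "inj h"
    and agree: "minus_convergences_agree TYPE('i) \<S>"
    and S: "S \<in> \<S>" and A: "A \<in> CL"
    and below: "uniformly_below_on S f g" and hits: "hits_pointwise A S f"
  shows "\<exists>S'\<in>\<S>. hits_pointwise (A \<inter> S') S g"
proof -
  obtain \<delta> where \<delta>: "\<delta> > 0" "\<And>x. x \<in> S \<Longrightarrow> f x + \<delta> \<le> g x"
    using below unfolding uniformly_below_on_iff[OF bornology_nonempty[OF bor S]] by blast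
  \<comment> \<open>Only members meeting \<open>A\<close> serve as indices, so every
    \<open>N i\<close> is nonempty; the closure makes it an element of \<open>CL\<close>.\<close>
  define D where "D = h ` {T \<in> \<S>. A \<inter> T \<noteq> {}}"
  define le where "le = (\<lambda>i j. inv h i \<subseteq> inv h j)"
  define N where "N = (\<lambda>i. closure (A \<inter> inv h i))"
  obtain a where a: "a \<in> A" using A by (auto simp: CL_def)
  \<comment> \<open>Adjoining \<open>T0\<close> turns any member of the bornology into one that
    meets \<open>A\<close>, hence into an index.\<close>
  obtain T0 where T0: "T0 \<in> \<S>" "a \<in> T0" using bornology_covers[OF bor] .
  have T0_D: "h (T \<union> T0) \<in> D" if "T \<in> \<S>" for T
    using bornology_Un[OF bor that T0(1)] a T0(2) by (auto simp: D_def)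
  have "directed_set D le"
    unfolding directed_set_def
  proof (intro conjI ballI impI)
    show "D \<noteq> {}" using T0_D[OF T0(1)] by blast
  next
    fix i j assume "i \<in> D" "j \<in> D"
    then obtain T U where T: "T \<in> \<S>" "A \<inter> T \<noteq> {}" "i = h T" and U: "U \<in> \<S>" "j = h U"
      by (auto simp: D_def)
    have "h (T \<union> U) \<in> D"
      using bornology_Un[OF bor T(1) U(1)] T(2) by (auto simp: D_def)
    moreover have "le i (h (T \<union> U))" "le j (h (T \<union> U))"
      using T U h by (auto simp: le_def)
    ultimately show "\<exists>k\<in>D. le i k \<and> le j k" by blast
  qed (auto simp: le_def)
  moreover have "\<forall>i\<in>D. N i \<in> CL"
    using h by (auto simp: D_def N_def CL_def)
  moreover have "S_minus_convergent \<S> D le N A"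
    unfolding S_minus_convergent_def net_eventually_def
  proof (intro allI impI ballI)
    fix \<epsilon> :: real and T assume \<epsilon>: "\<epsilon> > 0" and T: "T \<in> \<S>"
    \<comment> \<open>From this index on, \<open>N j\<close> contains \<open>A \<inter> T\<close>
      itself, so the distances are 0.\<close>
    have "A \<inter> T \<subseteq> set_enlargement (N j) \<epsilon>" if "le (h (T \<union> T0)) j" for j
    proof
      fix x assume "x \<in> A \<inter> T"
      then have "x \<in> N j"
        using that h closure_subset[of "A \<inter> inv h j"] by (auto simp: le_def N_def)
      then show "x \<in> set_enlargement (N j) \<epsilon>" using \<epsilon> by (simp add: set_enlargement_def)
    qed
    then show "\<exists>i\<in>D. \<forall>j\<in>D. le i j \<longrightarrow> A \<inter> T \<subseteq> set_enlargement (N j) \<epsilon>"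
      using T0_D[OF T] by blast
  qed
  ultimately have "tau_minus_convergent \<S> D le N A"
    using agree A unfolding minus_convergences_agree_def by blast
  \<comment> \<open>With \<delta> as tolerance, the threshold index itself satisfies the bound,
    since \<open>le\<close> is reflexive.\<close>
  then obtain i where i: "i \<in> D" "\<forall>x\<in>S. infdist x (N i) - infdist x A < \<delta>"
    using S \<delta>(1) unfolding tau_minus_convergent_def net_eventually_def le_def by blast
  then obtain T where T: "T \<in> \<S>" "A \<inter> T \<noteq> {}" and "i = h T"
    unfolding D_def by blast
  then have N_i: "N i = closure (A \<inter> T)" using h by (simp add: N_def)
  have "hits_pointwise (A \<inter> T) S g"
    unfolding hits_pointwise_def
  proof
    fix x assume x: "x \<in> S"
    obtain b where b: "b \<in> A" "dist x b < f x"
      using hits x unfolding hits_pointwise_def by fastforce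
    have "infdist x (N i) < infdist x A + \<delta>"
      using i(2) x by (simp add: diff_less_eq add.commute)
    also have "\<dots> < g x"
      using infdist_le[OF b(1), of x] b(2) \<delta>(2)[OF x] by linarith
    finally obtain c where "c \<in> N i" "dist x c < g x"
      using T(2) N_i by (auto elim: infdist_less_obtain[rotated])
    \<comment> \<open>The point \<open>c\<close> lies only in the closure, but an open ball that
      meets the closure of a set meets the set.\<close>
    then have "ball x (g x) \<inter> closure (A \<inter> T) \<noteq> {}" by (auto simp: N_i)
    then show "A \<inter> T \<inter> ball x (g x) \<noteq> {}"
      unfolding open_Int_closure_eq_empty[OF open_ball] by (simp add: Int_commute)
  qed
  with T(1) show ?thesis by blast
qed

theorem theorem3p8:
  fixes \<S> :: "'a::metric_space set set"
  assumes "bornology \<S>"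
  shows "(minus_convergences_agree TYPE('a set + 'j) \<S> \<longleftrightarrow>
          (\<forall>S\<in>\<S>. \<forall>A\<in>CL. \<forall>f\<in>Zplus. \<forall>g\<in>Zplus.
             uniformly_below_on S f g \<longrightarrow> hits_pointwise A S f \<longrightarrow>
             (\<exists>S'\<in>\<S>. hits_pointwise (A \<inter> S') S g)))
       \<and> ((\<forall>S\<in>\<S>. \<forall>A\<in>CL. \<forall>f\<in>Zplus. \<forall>g\<in>Zplus.
             uniformly_below_on S f g \<longrightarrow> hits_pointwise A S f \<longrightarrow>
             (\<exists>S'\<in>\<S>. hits_pointwise (A \<inter> S') S g)) \<longleftrightarrow>
          (\<forall>S\<in>\<S>. \<forall>A\<in>CL. \<forall>f\<in>LZplus. \<forall>g\<in>LZplus.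
             uniformly_below_on S f g \<longrightarrow> hits_pointwise A S f \<longrightarrow>
             (\<exists>S'\<in>\<S>. hits_pointwise (A \<inter> S') S g)))"
    (is "(?i \<longleftrightarrow> ?ii) \<and> (_ \<longleftrightarrow> ?iii)")
proof -
  \<comment> \<open>The left summand of the index type provides the injection \<open>Inl\<close>;
    the three implications then close a cycle.\<close>
  have "?ii" if "?i"
    using hits_pointwise_if_minus_convergences_agree[OF assms inj_Inl that] by blast
  moreover have "?iii" if "?ii"
    using that unfolding LZplus_def by blast
  moreover have "?i" if "?iii"
    unfolding minus_convergences_agree_def
  proof (intro allI ballI impI iffI)
    fix D :: "('a set + 'j) set" and le and N :: "'a set + 'j \<Rightarrow> 'a set" and A :: "'a set"
    assume A: "A \<in> CL"
    show "S_minus_convergent \<S> D le N A" if "tau_minus_convergent \<S> D le N A"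
      using tau_minus_imp_S_minus[OF that] .
    show "tau_minus_convergent \<S> D le N A" if "S_minus_convergent \<S> D le N A"
      by (rule S_minus_imp_tau_minus[OF assms A _ that]) (use \<open>?iii\<close> A in blast)
  qed
  ultimately show ?thesis by blast
qed

end
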